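(* Let $A \in \mathbb{C}^{m \times n}$, $W \in \mathbb{C}^{n \times m}$ and $k = \mathrm{ind}(A, W)$. If $r(WAW)=r(A)$, then $$A\{1',2',3',{1^{k}}'\} = \{X+(I_m-XWAW)A^{D,W}WAWX \mid X \in A\{1',2',3'\}\}$$ $$= \{X+(I_m-XWAW)YWAWX \mid X \in A\{1',2',3'\},\ Y \in A\{{1^{k}}'\}\}$$ and $$A\{1',2',4',{{}^{k}1}'\} = \{X+XWAWA^{D,W}(I_n-WAWX) \mid X \in A\{1',2',4'\}\}$$ $$= \{X+XWAWY(I_n-WAWX) \mid X \in A\{1',2',4'\},\ Y \in A\{{{}^{k}1}'\}\}.$$ Moreover, $A\{1',2',3',{1^{k}}'\}\neq \emptyset$ if and only if $r(WAW)=r(A)$, and likewise $A\{1',2',4',{{}^{k}1}'\}\neq \emptyset$ if and only if $r(WAW)=r(A)$.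
   Context: $r(\cdot)$ denotes rank, $*$ conjugate transpose. The index $\mathrm{ind}(M)$ of a square matrix $M$ is the smallest non-negative integer $j$ with $r(M^j)=r(M^{j+1})$ (with $M^0=I$); $\mathrm{ind}(A,W)=\max\{\mathrm{ind}(AW),\mathrm{ind}(WA)\}$. For $A,X \in \mathbb{C}^{m \times n}$, $W \in \mathbb{C}^{n \times m}$ and $k\ge \mathrm{ind}(A,W)$ consider the equations: $(1')$ $AWXWA=A$; $(2')$ $XWAWX=X$; $(3')$ $(WAWX)^*=WAWX$; $(4')$ $(XWAW)^*=XWAW$; $({1^k}')$ $XW(AW)^{k+1}=(AW)^k$; $({{}^k1}')$ $(AW)^{k+2}X=(AW)^kA$. A symbol such as $A\{1',2',3',{1^k}'\}$ or $A\{{1^k}'\}$ denotes the set of all $X\in\mathbb{C}^{m\times n}$ satisfying the listed equations. The $W$-weighted Drazin inverse $A^{D,W}\in\mathbb{C}^{m\times n}$ is the unique $X$ satisfying $XW(AW)^{k+1}=(AW)^k$, $XWAWX=X$, $AWX=XWA$ with $k=\mathrm{ind}(A,W)$; equivalently $A^{D,W}=A[(WA)^D]^2=[(AW)^D]^2A$, where $M^D$ is the Drazin inverse. *)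

theory Defs
  imports "HOL-Analysis.Analysis"
begin

definition conj_transpose :: "complex^'n^'m \<Rightarrow> complex^'m^'n"
  where "conj_transpose M = map_matrix cnj (transpose M)"

(* The library's power on type vec multiplies entrywise, so the power with respect to
   the matrix product has to be defined separately. *)
primrec mat_pow :: "complex^'m^'m \<Rightarrow> nat \<Rightarrow> complex^'m^'m"
  where
    "mat_pow M 0 = mat 1"
  | "mat_pow M (Suc j) = M ** mat_pow M j"

definition mat_index :: "complex^'m^'m \<Rightarrow> nat"
  where "mat_index M = (LEAST j. rank (mat_pow M j) = rank (mat_pow M (j + 1)))"

definition weighted_index :: "complex^'n^'m \<Rightarrow> complex^'m^'n \<Rightarrow> nat"
  where "weighted_index A W = max (mat_index (A ** W)) (mat_index (W ** A))"

(* Labels of the W-weighted matrix equations: Eq1, ..., Eq4 stand for (1'), ..., (4'),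
   Eq1k k for ({1^k}') with X on the left of the power of AW, and Eqk1 k for ({^k 1}')
   with X on the right. *)
datatype weqn = Eq1 | Eq2 | Eq3 | Eq4 | Eq1k nat | Eqk1 nat

primrec satisfies_weqn ::
  "complex^'n^'m \<Rightarrow> complex^'m^'n \<Rightarrow> complex^'n^'m \<Rightarrow> weqn \<Rightarrow> bool"
  where
    "satisfies_weqn A W X Eq1 \<longleftrightarrow> A ** W ** X ** W ** A = A"
  | "satisfies_weqn A W X Eq2 \<longleftrightarrow> X ** W ** A ** W ** X = X"
  | "satisfies_weqn A W X Eq3 \<longleftrightarrow> conj_transpose (W ** A ** W ** X) = W ** A ** W ** X"
  | "satisfies_weqn A W X Eq4 \<longleftrightarrow> conj_transpose (X ** W ** A ** W) = X ** W ** A ** W"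
  | "satisfies_weqn A W X (Eq1k k) \<longleftrightarrow>
       X ** W ** mat_pow (A ** W) (k + 1) = mat_pow (A ** W) k"
  | "satisfies_weqn A W X (Eqk1 k) \<longleftrightarrow>
       mat_pow (A ** W) (k + 2) ** X = mat_pow (A ** W) k ** A"

(* The set written A{...} in the literature, with the weight W made explicit. *)
definition weighted_inverses ::
  "complex^'n^'m \<Rightarrow> complex^'m^'n \<Rightarrow> weqn set \<Rightarrow> (complex^'n^'m) set"
  where "weighted_inverses A W E = {X. \<forall>e\<in>E. satisfies_weqn A W X e}"

definition weighted_drazin :: "complex^'n^'m \<Rightarrow> complex^'m^'n \<Rightarrow> complex^'n^'m"
  where "weighted_drazin A W =
    (THE X. X ** W ** mat_pow (A ** W) (weighted_index A W + 1)
              = mat_pow (A ** W) (weighted_index A W)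
          \<and> X ** W ** A ** W ** X = X
          \<and> A ** W ** X = X ** W ** A)"

end

theory Submission
  imports Defs
begin

text \<open>
  Put \<open>B = WAW\<close>. The correction term added to \<open>X\<close> is annihilated by \<open>AW\<close> from the left (for the
  first family) or by \<open>WA\<close> from the right (for the second), so it affects neither \<open>BX\<close> resp. \<open>XB\<close>
  nor the first equation, while it repairs the power equation. Conversely, if \<open>X\<close> already satisfies
  the power equation, then \<open>XB(AW)\<^sup>k = (AW)\<^sup>k\<close> (dually, \<open>(WA)\<^sup>k\<^sup>+\<^sup>1BX = (WA)\<^sup>k\<^sup>+\<^sup>1\<close>);
  the weighted Drazin inverse factors through these powers, so its correction term
  is zero, and the correction term for \<open>Y = X\<close> vanishes because \<open>XBX = X\<close>. When \<open>B\<close> and \<open>A\<close> have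
  equal rank, \<open>W\<close> can be cancelled on both sides of \<open>BXB = B\<close>, which makes \<open>{1,2,3}\<close>- and
  \<open>{1,2,4}\<close>-inverses of \<open>B\<close> weighted inverses of \<open>A\<close>.
\<close>

section \<open>Matrices over a field\<close>

lemma matrix_add_rdistrib: "(A + B) ** C = A ** C + B ** C"
  for A :: "'a::semiring_1^'n^'m"
  by (vector matrix_matrix_mult_def sum.distrib distrib_right)

lemma matrix_diff_ldistrib: "A ** (B - C) = A ** B - A ** C"
  for A :: "'a::ring_1^'n^'m"
  by (vector matrix_matrix_mult_def sum_subtractf right_diff_distrib)

lemma matrix_diff_rdistrib: "(A - B) ** C = A ** C - B ** C"
  for A :: "'a::ring_1^'n^'m"
  by (vector matrix_matrix_mult_def sum_subtractf left_diff_distrib)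

lemma matrix_mult_zero [simp]: "A ** 0 = 0" "0 ** A = 0"
  by (vector matrix_matrix_mult_def)+

text \<open>Expand each column over a basis \<open>B\<close> of the column space. Read entrywise,
  this writes every row as a combination of vectors indexed by \<open>B\<close>, so
  \<open>card B\<close> bounds the row rank.\<close>

lemma rank_transpose_le:
  fixes A :: "'a::field^'n^'m"
  shows "rank A \<le> rank (transpose A)"
proof -
  obtain B where B: "B \<subseteq> columns A" "vec.independent B" "columns A \<subseteq> vec.span B"
      "card B = vec.dim (columns A)"
    using vec.basis_exists by metis
  have fin: "finite B"
    using B(2) by (rule vec.finiteI_independent)
  have "\<exists>q. column j A = (\<Sum>b\<in>B. q b *s b)" for j
  proof -
    have "column j A \<in> vec.span B"
      using B(3) by (auto simp: columns_def)
    then show ?thesis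
      unfolding vec.span_finite[OF fin] by auto
  qed
  then obtain q where q: "\<And>j. column j A = (\<Sum>b\<in>B. q j b *s b)"
    by metis
  define R where "R = (\<lambda>b. \<chi> j. q j b) ` B"
  have "row i A = (\<Sum>b\<in>B. (b $ i) *s (\<chi> j. q j b))" for i
  proof -
    have "A $ i $ j = (\<Sum>b\<in>B. q j b * b $ i)" for j
      using arg_cong[OF q[of j], of "\<lambda>v. v $ i"] by (simp add: column_def)
    then show ?thesis
      by (simp add: vec_eq_iff row_def mult.commute)
  qed
  moreover have "(\<Sum>b\<in>B. (b $ i) *s (\<chi> j. q j b)) \<in> vec.span R" for i
    by (intro vec.span_sum vec.span_scale vec.span_base) (auto simp: R_def)
  ultimately have "rows A \<subseteq> vec.span R"
    by (auto simp: rows_def)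
  then have "vec.dim (rows A) \<le> card R"
    by (intro vec.dim_le_card) (auto simp: R_def fin)
  also have "\<dots> \<le> card B"
    unfolding R_def by (rule card_image_le[OF fin])
  finally show ?thesis
    by (simp add: row_rank_def_gen B(4))
qed

lemma rank_transpose_field: "rank (transpose A) = rank A"
  for A :: "'a::field^'n^'m"
  using rank_transpose_le[of A] rank_transpose_le[of "transpose A"] by simp

section \<open>Rank as the dimension of the range; factorizations from equal ranks\<close>

lemma span_columns_eq_range: "vec.span (columns A) = range ((*v) A)"
  for A :: "'a::field^'n^'m"
proof
  have "columns A \<subseteq> range ((*v) A)"
  proof
    fix v assume "v \<in> columns A"
    then obtain j where "v = column j A"
      by (auto simp: columns_def)
    then have "v = A *v axis j 1"
      by (vector matrix_vector_mult_def column_def axis_def)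
         (simp add: if_distrib cong: if_cong)
    then show "v \<in> range ((*v) A)"
      by blast
  qed
  moreover have "vec.subspace (range ((*v) A))"
    by (intro vec.linear_subspace_image) auto
  ultimately show "vec.span (columns A) \<subseteq> range ((*v) A)"
    by (rule vec.span_minimal)
qed (auto intro: matrix_vector_mult_in_columnspace_gen)

lemma rank_eq_dim_range: "rank A = vec.dim (range ((*v) A))"
  for A :: "'a::field^'n^'m"
  by (metis rank_transpose_field row_rank_def_gen rows_transpose span_columns_eq_range vec.dim_span)

lemma range_matrix_mult_subset: "range ((*v) (A ** B)) \<subseteq> range ((*v) A)"
  by (auto simp: matrix_vector_mul_assoc[symmetric])

lemma rank_mult_le_left: "rank (A ** B) \<le> rank A"
  for A :: "'a::field^'n^'m"
  unfolding rank_eq_dim_range by (rule vec.dim_subset[OF range_matrix_mult_subset])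

lemma rank_mult_le_right: "rank (A ** B) \<le> rank B"
  for A :: "'a::field^'n^'m"
  by (metis rank_mult_le_left rank_transpose_field matrix_transpose_mul)

text \<open>\<open>G\<close> is the matrix of a linear map that picks a preimage of each vector in
  the range of \<open>A\<close>.\<close>

lemma matrix_inner_inverse_exists:
  fixes A :: "'a::field^'n^'m"
  shows "\<exists>G. A ** G ** A = A"
proof -
  obtain g where g: "Vector_Spaces.linear (*s) (*s) g" "\<And>v. v \<in> range ((*v) A) \<Longrightarrow> A *v g v = v"
    using vec.linear_exists_right_inverse_on[OF matrix_vector_mul_linear_gen[of A] vec.subspace_UNIV]
    by blast
  have "(A ** matrix g ** A) *v x = A *v x" for x
    by (simp add: matrix_vector_mul_assoc[symmetric] matrix_works[OF g(1)] g(2))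
  then show ?thesis
    by (auto simp: matrix_eq)
qed

text \<open>Equal ranks force equal ranges. For an inner inverse \<open>G\<close> of
  \<open>A ** W\<close>, the product \<open>A ** W ** G\<close> fixes that range, so
  \<open>C = G ** A\<close> works.\<close>

lemma rank_eq_imp_right_factor:
  fixes A :: "'a::field^'n^'m" and W :: "'a^'p^'n"
  assumes "rank (A ** W) = rank A"
  obtains C where "A ** W ** C = A"
proof -
  have "range ((*v) (A ** W)) = range ((*v) A)"
    using assms unfolding rank_eq_dim_range
    by (intro vec.subspace_dim_equal vec.linear_subspace_image range_matrix_mult_subset) auto
  then have *: "\<exists>y. A *v x = (A ** W) *v y" for x
    by (metis rangeE rangeI)
  obtain G where G: "A ** W ** G ** (A ** W) = A ** W"
    using matrix_inner_inverse_exists by blast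
  have "(A ** W ** G ** A) *v x = A *v x" for x
    using *[of x] by (metis G matrix_vector_mul_assoc)
  then have "A ** W ** (G ** A) = A"
    by (simp add: matrix_eq matrix_mul_assoc)
  then show thesis
    by (rule that)
qed

lemma rank_eq_imp_left_factor:
  fixes A :: "'a::field^'n^'m" and W :: "'a^'m^'p"
  assumes "rank (W ** A) = rank A"
  obtains C where "C ** W ** A = A"
proof -
  have "rank (transpose A ** transpose W) = rank (transpose A)"
    by (metis assms matrix_transpose_mul rank_transpose_field)
  then obtain C where "transpose A ** transpose W ** C = transpose A"
    by (rule rank_eq_imp_right_factor)
  then have "transpose C ** W ** A = A"
    by (metis matrix_transpose_mul transpose_transpose matrix_mul_assoc)
  then show thesis
    by (rule that)
qed

section \<open>Conjugate transposes\<close>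

lemma conj_transpose_mult: "conj_transpose (A ** B) = conj_transpose B ** conj_transpose A"
  by (simp add: conj_transpose_def vec_eq_iff matrix_matrix_mult_def transpose_def mult.commute)

lemma conj_transpose_conj_transpose [simp]: "conj_transpose (conj_transpose A) = A"
  by (simp add: conj_transpose_def vec_eq_iff transpose_def)

lemma conj_transpose_diff: "conj_transpose (A - B) = conj_transpose A - conj_transpose B"
  by (simp add: conj_transpose_def vec_eq_iff transpose_def)

text \<open>The diagonal entries of the product are the squared norms of the columns of
  \<open>A\<close>.\<close>

lemma conj_transpose_mult_self_eq_zero:
  assumes "conj_transpose A ** A = 0"
  shows "A = 0"
proof -
  have "A $ i $ j = 0" for i j
  proof -
    have "(\<Sum>l\<in>UNIV. complex_of_real ((cmod (A $ l $ j))\<^sup>2)) = (conj_transpose A ** A) $ j $ j"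
      by (simp add: conj_transpose_def matrix_matrix_mult_def transpose_def
          complex_norm_square mult.commute del: of_real_power)
    then have "(\<Sum>l\<in>UNIV. (cmod (A $ l $ j))\<^sup>2) = 0"
      unfolding assms of_real_sum[symmetric] by (simp del: of_real_sum)
    then show ?thesis
      by (simp add: sum_nonneg_eq_0_iff)
  qed
  then show ?thesis
    by (simp add: vec_eq_iff)
qed

lemma inverse_123_exists:
  fixes B :: "complex^'n^'m"
  obtains X where "B ** X ** B = B" "X ** B ** X = X" "conj_transpose (B ** X) = B ** X"
proof -
  let ?C = "conj_transpose B"
  obtain G where G: "?C ** B ** G ** (?C ** B) = ?C ** B"
    using matrix_inner_inverse_exists by blast
  \<comment> \<open>This defect is zero: \<open>?C ** D = 0\<close>, and
    \<open>conj_transpose D\<close> has \<open>?C\<close> as right factor, so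
    \<open>conj_transpose D ** D = 0\<close>.\<close>
  define D where "D = B ** G ** ?C ** B - B"
  have *: "?C ** D = 0"
    using G by (simp add: D_def matrix_diff_ldistrib matrix_mul_assoc)
  have "conj_transpose D ** D = conj_transpose (G ** ?C ** B) ** (?C ** D) - ?C ** D"
    by (simp add: D_def matrix_diff_rdistrib matrix_diff_ldistrib conj_transpose_diff
        conj_transpose_mult matrix_mul_assoc)
  then have BGCB: "B ** G ** ?C ** B = B"
    using * conj_transpose_mult_self_eq_zero[of D] by (simp add: D_def)
  then have "conj_transpose (B ** G ** ?C ** B) = ?C"
    by simp
  then have CB: "?C ** B ** conj_transpose G ** ?C = ?C"
    by (simp add: conj_transpose_mult matrix_mul_assoc)
  have "B ** G ** ?C = B ** G ** (?C ** B ** conj_transpose G ** ?C)"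
    by (simp only: CB)
  also have "\<dots> = B ** conj_transpose G ** ?C"
    using BGCB by (simp add: matrix_mul_assoc)
  finally have herm: "conj_transpose (B ** G ** ?C) = B ** G ** ?C"
    by (simp add: conj_transpose_mult matrix_mul_assoc)
  define X where "X = G ** ?C"
  have BXB: "B ** X ** B = B" and BX: "conj_transpose (B ** X) = B ** X"
    using BGCB herm by (simp_all add: X_def matrix_mul_assoc)
  have BXBX: "B ** (X ** B ** X) = B ** X"
    using BXB by (simp add: matrix_mul_assoc)
  \<comment> \<open>So far \<open>X\<close> satisfies the first and third Penrose equations. Passing
    to \<open>X ** B ** X\<close> adds the second, and \<open>BXBX\<close> shows that the product
    with \<open>B\<close> on the left stays the same.\<close>
  show thesis
  proof (rule that)
    show "B ** (X ** B ** X) ** B = B"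
      by (simp only: BXBX BXB)
    have "X ** B ** X ** B ** (X ** B ** X) = X ** (B ** X ** B) ** (X ** B ** X)"
      by (simp only: matrix_mul_assoc)
    also have "\<dots> = X ** (B ** (X ** B ** X))"
      unfolding BXB by (simp only: matrix_mul_assoc)
    also have "\<dots> = X ** (B ** X)"
      by (simp only: BXBX)
    finally show "X ** B ** X ** B ** (X ** B ** X) = X ** B ** X"
      by (simp only: matrix_mul_assoc)
    show "conj_transpose (B ** (X ** B ** X)) = B ** (X ** B ** X)"
      by (simp only: BXBX BX)
  qed
qed

text \<open>Adjoints exchange left and right products, so the adjoint of a {1,2,3}-inverse of
  \<open>conj_transpose B\<close> serves.\<close>

lemma inverse_124_exists:
  fixes B :: "complex^'n^'m"
  obtains X where "B ** X ** B = B" "X ** B ** X = X" "conj_transpose (X ** B) = X ** B"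
proof -
  obtain Y where Y: "conj_transpose B ** Y ** conj_transpose B = conj_transpose B"
      "Y ** conj_transpose B ** Y = Y"
      "conj_transpose (conj_transpose B ** Y) = conj_transpose B ** Y"
    by (rule inverse_123_exists)
  show thesis
    by (rule that[of "conj_transpose Y"])
       (metis Y conj_transpose_mult conj_transpose_conj_transpose matrix_mul_assoc)+
qed

section \<open>The Drazin inverse\<close>

lemma mat_pow_add: "mat_pow M (i + j) = mat_pow M i ** mat_pow M j"
  by (induction i) (simp_all add: matrix_mul_assoc)

lemma mat_pow_Suc_right: "mat_pow M (Suc j) = mat_pow M j ** M"
  using mat_pow_add[of M j 1] by simp

lemma mat_pow_commutes: "M ** mat_pow M j = mat_pow M j ** M"
  using mat_pow_Suc_right[of M j] by simp

lemma mat_pow_mult_swap: "mat_pow (A ** B) j ** A = A ** mat_pow (B ** A) j"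
proof (induction j)
  case (Suc j)
  have "mat_pow (A ** B) (Suc j) ** A = A ** B ** (mat_pow (A ** B) j ** A)"
    by (simp add: matrix_mul_assoc)
  then show ?case
    by (simp add: Suc matrix_mul_assoc)
qed simp

text \<open>The ranks of the powers form a nonincreasing sequence of naturals and cannot drop at
  every step, so the minimum in \<open>mat_index\<close> is attained.\<close>

lemma rank_mat_pow_index: "rank (mat_pow M (mat_index M + 1)) = rank (mat_pow M (mat_index M))"
proof -
  have "\<exists>j. rank (mat_pow M j) = rank (mat_pow M (j + 1))"
  proof (rule ccontr)
    assume "\<not> ?thesis"
    moreover have "rank (mat_pow M (j + 1)) \<le> rank (mat_pow M j)" for j
      by (simp add: rank_mult_le_right)
    ultimately have less: "rank (mat_pow M (Suc j)) < rank (mat_pow M j)" for j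
      by (metis Suc_eq_plus1 le_neq_implies_less)
    have "rank (mat_pow M j) + j \<le> rank (mat_pow M 0)" for j
    proof (induction j)
      case (Suc j)
      then show ?case
        using less[of j] by linarith
    qed simp
    from this[of "Suc (rank (mat_pow M 0))"] show False
      by simp
  qed
  then have "rank (mat_pow M (mat_index M)) = rank (mat_pow M (mat_index M + 1))"
    unfolding mat_index_def by (rule LeastI_ex)
  then show ?thesis
    by simp
qed

text \<open>Rank equality at the index provides \<open>Z\<close> there; right multiplication by
  powers of \<open>M\<close> carries the same \<open>Z\<close> to every larger exponent.\<close>

lemma mat_pow_index_left:
  assumes "mat_index M \<le> k"
  obtains Z where "Z ** mat_pow M (Suc k) = mat_pow M k"
proof -
  let ?i = "mat_index M"
  obtain Z where Z: "Z ** M ** mat_pow M ?i = mat_pow M ?i"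
    by (rule rank_eq_imp_left_factor[of M "mat_pow M ?i"]) (use rank_mat_pow_index[of M] in simp)
  obtain d where k: "k = ?i + d"
    using assms le_Suc_ex by blast
  have "Z ** mat_pow M (Suc k) = Z ** M ** mat_pow M ?i ** mat_pow M d"
    by (simp add: k mat_pow_add matrix_mul_assoc)
  then have "Z ** mat_pow M (Suc k) = mat_pow M k"
    by (simp add: Z k mat_pow_add)
  then show thesis
    by (rule that)
qed

lemma mat_pow_index_right:
  assumes "mat_index M \<le> k"
  obtains Z where "mat_pow M (Suc k) ** Z = mat_pow M k"
proof -
  let ?i = "mat_index M"
  obtain Z where Z: "mat_pow M ?i ** M ** Z = mat_pow M ?i"
    by (rule rank_eq_imp_right_factor[of "mat_pow M ?i" M])
       (use rank_mat_pow_index[of M] in \<open>simp add: mat_pow_commutes\<close>)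
  obtain d where k: "k = d + ?i"
    using assms le_Suc_ex by (metis add.commute)
  have "mat_pow M (Suc k) ** Z = mat_pow M d ** (mat_pow M ?i ** M ** Z)"
    by (simp only: k mat_pow_Suc_right mat_pow_add matrix_mul_assoc)
  then have "mat_pow M (Suc k) ** Z = mat_pow M k"
    by (simp add: Z k mat_pow_add)
  then show thesis
    by (rule that)
qed

lemma mat_pow_left_iterate:
  assumes "Z ** mat_pow M (Suc k) = mat_pow M k"
  shows "mat_pow Z j ** mat_pow M (k + j) = mat_pow M k"
proof (induction j)
  case (Suc j)
  have "mat_pow Z (Suc j) ** mat_pow M (k + Suc j)
      = mat_pow Z j ** (Z ** mat_pow M (Suc k)) ** mat_pow M j"
    by (simp only: mat_pow_Suc_right[of Z] add_Suc_right add_Suc[symmetric] mat_pow_add matrix_mul_assoc)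
  also have "\<dots> = mat_pow Z j ** mat_pow M (k + j)"
    by (simp only: assms mat_pow_add matrix_mul_assoc)
  finally show ?case
    by (simp only: Suc)
qed simp

lemma mat_pow_right_iterate:
  assumes "mat_pow M (Suc k) ** Z = mat_pow M k"
  shows "mat_pow M (j + k) ** mat_pow Z j = mat_pow M k"
proof (induction j)
  case (Suc j)
  have "mat_pow M (Suc j + k) ** mat_pow Z (Suc j)
      = mat_pow M j ** (mat_pow M (Suc k) ** Z) ** mat_pow Z j"
    by (simp only: mat_pow.simps(2)[of Z] add_Suc add_Suc_right[symmetric] mat_pow_add matrix_mul_assoc)
  also have "\<dots> = mat_pow M (j + k) ** mat_pow Z j"
    by (simp only: assms mat_pow_add)
  finally show ?case
    by (simp only: Suc)
qed simp

text \<open>\<open>E\<close> has one expression through a left factor \<open>Y\<close> and one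
  through a right factor \<open>Z\<close>. Each property follows from the expression in which the
  excess powers of \<open>M\<close> cancel.\<close>

lemma drazin_exists:
  assumes "mat_index M \<le> k"
  obtains E where "E ** M = M ** E" "E ** M ** E = E" "E ** mat_pow M (k + 1) = mat_pow M k"
proof -
  obtain Y where Y1: "Y ** mat_pow M (Suc k) = mat_pow M k"
    using mat_pow_index_left[OF assms] .
  note Y = mat_pow_left_iterate[OF Y1]
  obtain Z where "mat_pow M (Suc k) ** Z = mat_pow M k"
    using mat_pow_index_right[OF assms] .
  note Z = mat_pow_right_iterate[OF this]
  \<comment> \<open>Both sides come from
    \<open>mat_pow Y j ** mat_pow M (k + j) ** mat_pow Z j\<close>, collapsed from the left and from
    the right.\<close>
  have swap: "mat_pow M k ** mat_pow Z j = mat_pow Y j ** mat_pow M k" for j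
  proof -
    have "mat_pow M k ** mat_pow Z j = mat_pow Y j ** mat_pow M (k + j) ** mat_pow Z j"
      by (simp only: Y)
    also have "\<dots> = mat_pow Y j ** (mat_pow M (j + k) ** mat_pow Z j)"
      by (simp only: matrix_mul_assoc add.commute)
    finally show ?thesis
      by (simp only: Z)
  qed
  define E where "E = mat_pow M k ** mat_pow Z (Suc k)"
  have E: "E = mat_pow Y (Suc k) ** mat_pow M k"
    by (simp only: E_def swap)
  have ME: "M ** E = mat_pow M k ** mat_pow Z k"
  proof -
    have "M ** E = mat_pow M (1 + k) ** mat_pow Z 1 ** mat_pow Z k"
      by (simp add: E_def matrix_mul_assoc)
    then show ?thesis
      by (simp only: Z)
  qed
  have EM: "E ** M = mat_pow Y k ** mat_pow M k"
  proof -
    have "E ** M = mat_pow Y k ** (Y ** mat_pow M (Suc k))"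
      by (simp only: E mat_pow_Suc_right matrix_mul_assoc)
    then show ?thesis
      by (simp only: Y1)
  qed
  show thesis
  proof (rule that)
    show "E ** M = M ** E"
      by (simp only: EM ME swap)
    have "E ** M ** E = mat_pow Y k ** mat_pow M k ** E"
      by (simp only: EM)
    also have "\<dots> = mat_pow Y k ** mat_pow M (k + k) ** mat_pow Z (Suc k)"
      by (simp only: E_def mat_pow_add matrix_mul_assoc)
    finally show "E ** M ** E = E"
      by (simp only: Y E_def)
    have "E ** mat_pow M (k + 1) = mat_pow Y (Suc k) ** mat_pow M (k + Suc k)"
      by (simp only: E mat_pow_add matrix_mul_assoc Suc_eq_plus1)
    then show "E ** mat_pow M (k + 1) = mat_pow M k"
      by (simp only: Y)
  qed
qed

text \<open>Exposes arbitrarily high powers of \<open>M\<close> inside \<open>P\<close>, to which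
  the power equation of another Drazin inverse can be applied.\<close>

lemma drazin_power_left:
  assumes "P ** M = M ** P" "P ** M ** P = P"
  shows "mat_pow P (Suc j) ** mat_pow M j = P"
proof (induction j)
  case (Suc j)
  have "mat_pow P (Suc (Suc j)) ** mat_pow M (Suc j) = P ** (mat_pow P (Suc j) ** mat_pow M j) ** M"
    by (simp only: mat_pow.simps(2)[of P] mat_pow_Suc_right[of M] matrix_mul_assoc)
  also have "\<dots> = P ** M ** P"
    unfolding Suc using assms(1) by (metis matrix_mul_assoc)
  finally show ?case
    using assms(2) by simp
qed simp

lemma drazin_power_right:
  assumes "P ** M = M ** P" "P ** M ** P = P"
  shows "mat_pow M j ** mat_pow P (Suc j) = P"
proof (induction j)
  case (Suc j)
  have "mat_pow M (Suc j) ** mat_pow P (Suc (Suc j)) = M ** (mat_pow M j ** mat_pow P (Suc j)) ** P"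
    by (simp only: mat_pow.simps(2)[of M] mat_pow_Suc_right[of P "Suc j"] matrix_mul_assoc)
  also have "\<dots> = P ** M ** P"
    using assms(1) by (simp only: Suc matrix_mul_assoc)
  finally show ?case
    using assms(2) by simp
qed simp

text \<open>Both inverses equal \<open>P ** M ** Q\<close>: expand \<open>P\<close> with powers of
  \<open>M\<close> on its right and \<open>Q\<close> with powers of \<open>M\<close> on its left,
  then apply the power equation of the other one.\<close>

lemma drazin_unique:
  assumes P: "P ** M = M ** P" "P ** M ** P = P" "P ** mat_pow M (k + 1) = mat_pow M k"
    and Q: "Q ** M = M ** Q" "Q ** M ** Q = Q" "Q ** mat_pow M (k + 1) = mat_pow M k"
  shows "P = Q"
proof -
  have comm: "Q ** mat_pow M j = mat_pow M j ** Q" for j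
    by (induction j) (simp, metis Q(1) mat_pow.simps(2) matrix_mul_assoc)
  have "P = mat_pow P (Suc k) ** (mat_pow M (Suc k) ** Q)"
    using drazin_power_left[OF P(1,2)] Q(3) comm by (metis Suc_eq_plus1)
  also have "\<dots> = mat_pow P (Suc k) ** mat_pow M k ** M ** Q"
    by (simp only: mat_pow_Suc_right[of M] matrix_mul_assoc)
  finally have "P = P ** M ** Q"
    by (simp only: drazin_power_left[OF P(1,2)])
  moreover have "Q = P ** mat_pow M (Suc k) ** mat_pow Q (Suc k)"
    using drazin_power_right[OF Q(1,2)] P(3) by (metis Suc_eq_plus1)
  then have "Q = P ** M ** (mat_pow M k ** mat_pow Q (Suc k))"
    by (simp add: matrix_mul_assoc)
  then have "Q = P ** M ** Q"
    by (simp only: drazin_power_right[OF Q(1,2)])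
  ultimately show ?thesis
    by metis
qed

text \<open>Justifies the definite description in \<open>weighted_drazin\<close>. Existence and
  uniqueness both reduce to the ordinary Drazin inverse \<open>E\<close> of
  \<open>A ** W\<close>.\<close>

lemma weighted_drazin_props:
  fixes A :: "complex^'n^'m" and W :: "complex^'m^'n"
  defines "k \<equiv> weighted_index A W" and "D \<equiv> weighted_drazin A W"
  shows "D ** W ** mat_pow (A ** W) (k + 1) = mat_pow (A ** W) k"
    and "D ** W ** A ** W ** D = D"
    and "A ** W ** D = D ** W ** A"
proof -
  let ?M = "A ** W"
  let ?P = "\<lambda>X. X ** W ** mat_pow ?M (k + 1) = mat_pow ?M k \<and> X ** W ** A ** W ** X = X
      \<and> A ** W ** X = X ** W ** A"
  have "mat_index ?M \<le> k"
    by (simp add: k_def weighted_index_def)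
  then obtain E where E: "E ** ?M = ?M ** E" "E ** ?M ** E = E"
      "E ** mat_pow ?M (k + 1) = mat_pow ?M k"
    by (rule drazin_exists)
  have EEM: "E ** E ** ?M = E"
    using E by (metis matrix_mul_assoc)
  let ?X = "E ** E ** A"  \<comment> \<open>the representation \<open>[(AW)\<^sup>D]\<^sup>2 A\<close>\<close>
  have XW: "?X ** W = E"
    using EEM by (simp add: matrix_mul_assoc)
  have "?P ?X"
  proof (intro conjI)
    show "?X ** W ** mat_pow ?M (k + 1) = mat_pow ?M k"
      using E(3) by (simp only: XW)
    have "?X ** W ** A ** W ** ?X = (E ** ?M ** E) ** E ** A"
      by (simp only: XW matrix_mul_assoc)
    then show "?X ** W ** A ** W ** ?X = ?X"
      by (simp only: E(2))
    have "A ** W ** ?X = (?M ** E) ** E ** A"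
      by (simp only: matrix_mul_assoc)
    also have "\<dots> = (E ** ?M ** E) ** A"
      by (simp only: E(1))
    also have "\<dots> = ?X ** W ** A"
      by (simp only: E(2) XW)
    finally show "A ** W ** ?X = ?X ** W ** A" .
  qed
  \<comment> \<open>Uniqueness: \<open>X ** W\<close> is a Drazin inverse of \<open>?M\<close>,
    hence \<open>E\<close>, and the last two conditions recover \<open>X\<close> from it.\<close>
  moreover have "X = ?X" if X: "?P X" for X
  proof -
    have "X ** W = E"
    proof (rule drazin_unique)
      show "X ** W ** ?M = ?M ** (X ** W)"
        using X by (metis matrix_mul_assoc)
      show "X ** W ** ?M ** (X ** W) = X ** W"
        using X by (metis matrix_mul_assoc)
      show "X ** W ** mat_pow ?M (k + 1) = mat_pow ?M k"
        using X by blast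
    qed (fact E)+
    moreover have "X = X ** W ** (X ** W) ** A"
      using X by (metis matrix_mul_assoc)
    ultimately show ?thesis
      by simp
  qed
  ultimately have "?P D"
    unfolding D_def weighted_drazin_def k_def[symmetric] by (rule theI)
  then show "D ** W ** mat_pow (A ** W) (k + 1) = mat_pow (A ** W) k"
    and "D ** W ** A ** W ** D = D" and "A ** W ** D = D ** W ** A"
    by blast+
qed

text \<open>Substituting the commutation rule into \<open>D = D ** W ** A ** W ** D\<close> gives
  \<open>D = A ** W ** D ** W ** D\<close>, so each step splits off one more factor
  \<open>A ** W\<close>.\<close>

lemma weighted_drazin_factor_left:
  "\<exists>T. weighted_drazin A W = mat_pow (A ** W) j ** T"
proof (induction j)
  case (Suc j)
  let ?D = "weighted_drazin A W"
  obtain T where T: "?D = mat_pow (A ** W) j ** T"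
    using Suc by blast
  have "?D = A ** W ** ?D ** W ** ?D"
    by (simp only: weighted_drazin_props(2,3))
  then have "?D = mat_pow (A ** W) (Suc j) ** (T ** W ** ?D)"
    by (metis T mat_pow.simps(2) matrix_mul_assoc)
  then show ?case
    by blast
qed simp

lemma weighted_drazin_factor_right:
  "\<exists>T. weighted_drazin A W = T ** mat_pow (W ** A) j"
proof (induction j)
  case (Suc j)
  let ?D = "weighted_drazin A W"
  obtain T where T: "?D = T ** mat_pow (W ** A) j"
    using Suc by blast
  have "?D = ?D ** W ** ?D ** W ** A"
    by (metis weighted_drazin_props(2,3) matrix_mul_assoc)
  then have "?D = ?D ** W ** T ** mat_pow (W ** A) (Suc j)"
    by (metis T mat_pow_Suc_right matrix_mul_assoc)
  then show ?case
    by blast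
qed simp

section \<open>Weighted generalized inverses\<close>

text \<open>With \<open>Y\<close> arbitrary, this covers both descriptions of the family; the Drazin
  inverse is one choice of \<open>Y\<close>.\<close>

lemma mem_weighted_inverses_123k:
  assumes X: "X \<in> weighted_inverses A W {Eq1, Eq2, Eq3}" and Y: "Y \<in> weighted_inverses A W {Eq1k k}"
  shows "X + (mat 1 - X ** W ** A ** W) ** Y ** W ** A ** W ** X
    \<in> weighted_inverses A W {Eq1, Eq2, Eq3, Eq1k k}" (is "?Z \<in> _")
proof -
  let ?B = "W ** A ** W" and ?P = "mat_pow (A ** W) k"
  have 1: "A ** W ** X ** W ** A = A" and 2: "X ** W ** A ** W ** X = X"
    and 3: "conj_transpose (?B ** X) = ?B ** X"
    and Y': "Y ** W ** A ** W ** ?P = ?P"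
    using X Y by (simp_all add: weighted_inverses_def matrix_mul_assoc)
  have AWZ: "A ** W ** ?Z = A ** W ** X"
    by (simp add: matrix_add_ldistrib matrix_diff_ldistrib matrix_diff_rdistrib matrix_mul_assoc 1)
  have "W ** (A ** W ** ?Z) = W ** (A ** W ** X)"
    by (simp only: AWZ)
  then have BZ: "?B ** ?Z = ?B ** X"
    by (simp only: matrix_mul_assoc)
  have "?Z ** W ** A ** W ** X = X ** W ** A ** W ** X
      + (mat 1 - X ** W ** A ** W) ** Y ** W ** A ** W ** (X ** W ** A ** W ** X)"
    by (simp only: matrix_add_rdistrib matrix_mul_assoc)
  then have ZBX: "?Z ** W ** A ** W ** X = ?Z"
    by (simp only: 2)
  have "A ** W ** ?Z ** W ** A = A"
    by (simp only: AWZ 1)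
  moreover have "?Z ** W ** A ** W ** ?Z = ?Z"
  proof -
    have "?Z ** W ** A ** W ** ?Z = ?Z ** (?B ** ?Z)"
      by (simp only: matrix_mul_assoc)
    also have "\<dots> = ?Z ** W ** A ** W ** X"
      by (simp only: BZ matrix_mul_assoc)
    finally show ?thesis
      by (simp only: ZBX)
  qed
  moreover have "conj_transpose (?B ** ?Z) = ?B ** ?Z"
    by (simp only: BZ 3)
  \<comment> \<open>The summand \<open>X\<close> contributes \<open>X ** ?B ** ?P\<close>. By the
    first equation and \<open>Y'\<close>, the correction contributes the missing
    \<open>(mat 1 - X ** ?B) ** ?P\<close>.\<close>
  moreover have "?Z ** W ** mat_pow (A ** W) (k + 1) = ?P"
  proof -
    have "(mat 1 - X ** W ** A ** W) ** Y ** W ** A ** W ** X ** W ** A ** W ** ?P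
        = (mat 1 - X ** W ** A ** W) ** Y ** W ** (A ** W ** X ** W ** A) ** W ** ?P"
      by (simp only: matrix_mul_assoc)
    also have "\<dots> = (mat 1 - X ** W ** A ** W) ** (Y ** W ** A ** W ** ?P)"
      by (simp only: 1 matrix_mul_assoc)
    finally show ?thesis
      by (simp add: Y' matrix_add_rdistrib matrix_diff_rdistrib matrix_mul_assoc)
  qed
  ultimately show ?thesis
    by (simp add: weighted_inverses_def)
qed

lemma mem_weighted_inverses_124k:
  assumes X: "X \<in> weighted_inverses A W {Eq1, Eq2, Eq4}" and Y: "Y \<in> weighted_inverses A W {Eqk1 k}"
  shows "X + X ** W ** A ** W ** Y ** (mat 1 - W ** A ** W ** X)
    \<in> weighted_inverses A W {Eq1, Eq2, Eq4, Eqk1 k}" (is "?Z \<in> _")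
proof -
  let ?B = "W ** A ** W" and ?P = "mat_pow (A ** W) k"
  have 1: "A ** W ** X ** W ** A = A" and 2: "X ** W ** A ** W ** X = X"
    and 4: "conj_transpose (X ** W ** A ** W) = X ** W ** A ** W"
    and Y': "mat_pow (A ** W) (k + 2) ** Y = ?P ** A"
    using X Y by (simp_all add: weighted_inverses_def)
  have pow: "mat_pow (A ** W) (k + 2) = ?P ** A ** W ** A ** W"
    by (simp only: numeral_2_eq_2 add_Suc_right add_0_right mat_pow_Suc_right matrix_mul_assoc)
  have ZWA: "?Z ** W ** A = X ** W ** A"
  proof -
    have "(mat 1 - W ** A ** W ** X) ** W ** A = W ** A - W ** (A ** W ** X ** W ** A)"
      by (simp add: matrix_diff_rdistrib matrix_mul_assoc)
    then have *: "(mat 1 - W ** A ** W ** X) ** W ** A = 0"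
      by (simp add: 1)
    have "?Z ** W ** A = X ** W ** A + X ** W ** A ** W ** Y ** ((mat 1 - W ** A ** W ** X) ** W ** A)"
      by (simp only: matrix_add_rdistrib matrix_mul_assoc)
    then show ?thesis
      by (simp add: *)
  qed
  have XBZ: "X ** W ** A ** W ** ?Z = ?Z"
    by (simp add: matrix_add_ldistrib matrix_mul_assoc 2)
  have "A ** W ** ?Z ** W ** A = A"
    using ZWA 1 by (metis matrix_mul_assoc)
  moreover have "?Z ** W ** A ** W ** ?Z = ?Z"
    by (simp only: ZWA XBZ)
  moreover have "conj_transpose (?Z ** W ** A ** W) = ?Z ** W ** A ** W"
    by (simp only: ZWA 4)
  \<comment> \<open>The summand \<open>X\<close> contributes \<open>?P ** A ** ?B ** X\<close>, and
    by \<open>Y'\<close> the correction contributes the complement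
    \<open>?P ** A ** (mat 1 - ?B ** X)\<close>.\<close>
  moreover have "mat_pow (A ** W) (k + 2) ** ?Z = ?P ** A"
  proof -
    have "mat_pow (A ** W) (k + 2) ** X ** W ** A ** W
        = ?P ** A ** W ** (A ** W ** X ** W ** A) ** W"
      by (simp only: pow matrix_mul_assoc)
    then have "mat_pow (A ** W) (k + 2) ** X ** W ** A ** W = mat_pow (A ** W) (k + 2)"
      by (simp only: 1 pow)
    then have "mat_pow (A ** W) (k + 2) ** ?Z = mat_pow (A ** W) (k + 2) ** X
        + ?P ** A ** (mat 1 - W ** A ** W ** X)"
      using Y' by (simp add: matrix_add_ldistrib matrix_mul_assoc del: add_2_eq_Suc')
    then show ?thesis
      by (simp add: pow matrix_diff_ldistrib matrix_mul_assoc del: add_2_eq_Suc')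
  qed
  ultimately show ?thesis
    by (simp add: weighted_inverses_def del: add_2_eq_Suc')
qed

lemma weighted_drazin_mem:
  "weighted_drazin A W \<in> weighted_inverses A W {Eq1k (weighted_index A W)}"
  "weighted_drazin A W \<in> weighted_inverses A W {Eqk1 (weighted_index A W)}"
proof -
  let ?D = "weighted_drazin A W" and ?k = "weighted_index A W"
  note D = weighted_drazin_props[of A W]
  show "?D \<in> weighted_inverses A W {Eq1k ?k}"
    using D(1) by (simp add: weighted_inverses_def)
  \<comment> \<open>Moving \<open>?D ** W\<close> to the left of the power brings the right-sided
    equation within reach of the left-sided one, \<open>D(1)\<close>.\<close>
  have comm: "mat_pow (A ** W) j ** (?D ** W) = ?D ** W ** mat_pow (A ** W) j" for j
    by (induction j) (simp, metis D(3) mat_pow.simps(2) matrix_mul_assoc)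
  have "mat_pow (A ** W) (?k + 2) = mat_pow (A ** W) (?k + 1) ** (A ** W)"
    using mat_pow_Suc_right[of "A ** W" "?k + 1"] by simp
  then have "mat_pow (A ** W) (?k + 2) ** ?D = mat_pow (A ** W) (?k + 1) ** (?D ** W) ** A"
    using D(3) by (metis matrix_mul_assoc)
  then have "mat_pow (A ** W) (?k + 2) ** ?D = mat_pow (A ** W) ?k ** A"
    by (simp only: comm D(1))
  then show "?D \<in> weighted_inverses A W {Eqk1 ?k}"
    by (simp add: weighted_inverses_def)
qed

lemma weighted_inverses_123k_drazin:
  assumes "X \<in> weighted_inverses A W {Eq1k k}"
  shows "(mat 1 - X ** W ** A ** W) ** weighted_drazin A W = 0"
proof -
  obtain T where "weighted_drazin A W = mat_pow (A ** W) k ** T"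
    using weighted_drazin_factor_left by blast
  moreover have "X ** W ** A ** W ** mat_pow (A ** W) k = mat_pow (A ** W) k"
    using assms by (simp add: weighted_inverses_def matrix_mul_assoc)
  ultimately show ?thesis
    by (simp add: matrix_diff_rdistrib matrix_mul_assoc)
qed

lemma weighted_inverses_124k_drazin:
  assumes "X \<in> weighted_inverses A W {Eqk1 k}"
  shows "weighted_drazin A W ** (mat 1 - W ** A ** W ** X) = 0"
proof -
  \<comment> \<open>The exponent is \<open>k + 1\<close> because left multiplication by
    \<open>W\<close> turns the right-hand side of the power equation,
    \<open>mat_pow (A ** W) k ** A\<close>, into \<open>mat_pow (W ** A) (k + 1)\<close>.\<close>
  obtain T where T: "weighted_drazin A W = T ** mat_pow (W ** A) (k + 1)"
    using weighted_drazin_factor_right by blast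
  have *: "mat_pow (A ** W) (k + 2) ** X = mat_pow (A ** W) k ** A"
    using assms by (simp add: weighted_inverses_def)
  have swap: "W ** mat_pow (A ** W) j = mat_pow (W ** A) j ** W" for j
    by (rule mat_pow_mult_swap[symmetric])
  have "mat_pow (W ** A) (k + 1) ** (W ** A ** W ** X) = mat_pow (W ** A) (k + 2) ** W ** X"
    using mat_pow_Suc_right[of "W ** A" "k + 1"] by (simp add: matrix_mul_assoc)
  also have "\<dots> = W ** (mat_pow (A ** W) (k + 2) ** X)"
    by (simp only: swap[symmetric] matrix_mul_assoc)
  also have "\<dots> = mat_pow (W ** A) k ** (W ** A)"
    by (simp only: * matrix_mul_assoc swap)
  also have "\<dots> = mat_pow (W ** A) (k + 1)"
    using mat_pow_Suc_right[of "W ** A" k] by simp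
  finally show ?thesis
    unfolding T by (simp only: matrix_diff_ldistrib matrix_mul_rid matrix_mul_assoc[symmetric] diff_self)
qed

section \<open>The rank condition and existence\<close>

lemma weighted_eq1_imp_rank_eq:
  assumes "A ** W ** X ** W ** A = A"
  shows "rank (W ** A ** W) = rank A"
proof (rule antisym)
  show "rank (W ** A ** W) \<le> rank A"
    using rank_mult_le_left rank_mult_le_right order_trans by blast
  \<comment> \<open>substitute the equation into its own last factor \<open>A\<close>\<close>
  have "A = A ** W ** X ** (W ** A ** W) ** (X ** W ** A)"
    using assms by (metis matrix_mul_assoc)
  then show "rank A \<le> rank (W ** A ** W)"
    by (metis rank_mult_le_left rank_mult_le_right order_trans)
qed

text \<open>The ranks of \<open>W ** A\<close> and \<open>A ** W\<close> are squeezed between those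
  of \<open>W ** A ** W\<close> and \<open>A\<close>. The resulting factors \<open>C\<close> and
  \<open>E\<close> cancel the outer copies of \<open>W\<close> in \<open>X\<close>.\<close>

lemma rank_eq_imp_weighted_eq1:
  assumes "rank (W ** A ** W) = rank A" and X: "W ** A ** W ** X ** (W ** A ** W) = W ** A ** W"
  shows "A ** W ** X ** W ** A = A"
proof -
  have "rank (W ** A) = rank A"
    using assms(1) rank_mult_le_left[of "W ** A" W] rank_mult_le_right[of W A] by simp
  then obtain C where C: "C ** W ** A = A"
    by (rule rank_eq_imp_left_factor)
  have "rank (A ** W) = rank A"
    using assms(1) rank_mult_le_right[of W "A ** W"] rank_mult_le_left[of A W]
    by (simp add: matrix_mul_assoc)
  then obtain E where E: "A ** W ** E = A"
    by (rule rank_eq_imp_right_factor)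
  have "C ** (W ** A ** W ** X ** (W ** A ** W)) ** E = C ** (W ** A ** W) ** E"
    by (simp only: X)
  then have "(C ** W ** A) ** W ** X ** W ** (A ** W ** E) = (C ** W ** A) ** W ** E"
    by (simp only: matrix_mul_assoc)
  then show ?thesis
    by (simp only: C E)
qed

lemma rank_eq_imp_weighted_inverses_123_ne:
  assumes "rank (W ** A ** W) = rank A"
  shows "weighted_inverses A W {Eq1, Eq2, Eq3} \<noteq> {}"
proof -
  obtain X where X: "W ** A ** W ** X ** (W ** A ** W) = W ** A ** W" "X ** (W ** A ** W) ** X = X"
      "conj_transpose (W ** A ** W ** X) = W ** A ** W ** X"
    by (rule inverse_123_exists)
  then have "X \<in> weighted_inverses A W {Eq1, Eq2, Eq3}"
    using rank_eq_imp_weighted_eq1[OF assms X(1)]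
    by (simp add: weighted_inverses_def matrix_mul_assoc)
  then show ?thesis
    by blast
qed

lemma rank_eq_imp_weighted_inverses_124_ne:
  assumes "rank (W ** A ** W) = rank A"
  shows "weighted_inverses A W {Eq1, Eq2, Eq4} \<noteq> {}"
proof -
  obtain X where X: "W ** A ** W ** X ** (W ** A ** W) = W ** A ** W" "X ** (W ** A ** W) ** X = X"
      "conj_transpose (X ** (W ** A ** W)) = X ** (W ** A ** W)"
    by (rule inverse_124_exists)
  then have "X \<in> weighted_inverses A W {Eq1, Eq2, Eq4}"
    using rank_eq_imp_weighted_eq1[OF assms X(1)]
    by (simp add: weighted_inverses_def matrix_mul_assoc)
  then show ?thesis
    by blast
qed

section \<open>Set equalities from maps that fix their target pointwise\<close>

lemma eq_image_of_fixed_points: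
  assumes "\<And>x. x \<in> S \<Longrightarrow> f x \<in> L" "\<And>x. x \<in> L \<Longrightarrow> x \<in> S" "\<And>x. x \<in> L \<Longrightarrow> f x = x"
  shows "L = {f x | x. x \<in> S}"
proof (intro equalityI subsetI)
  show "x \<in> {f x | x. x \<in> S}" if "x \<in> L" for x
    using assms(2,3)[OF that] by (intro CollectI exI[of _ x]) simp
qed (use assms(1) in blast)

text \<open>The diagonal choice \<open>y = x\<close> is the witness; it becomes \<open>Y = X\<close>
  in the families with free \<open>Y\<close>.\<close>

lemma eq_image2_of_fixed_points:
  assumes "\<And>x y. x \<in> S \<Longrightarrow> y \<in> T \<Longrightarrow> f x y \<in> L"
    and "\<And>x. x \<in> L \<Longrightarrow> x \<in> S" "\<And>x. x \<in> L \<Longrightarrow> x \<in> T" "\<And>x. x \<in> L \<Longrightarrow> f x x = x"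
  shows "L = {f x y | x y. x \<in> S \<and> y \<in> T}"
proof (intro equalityI subsetI)
  show "x \<in> {f x y | x y. x \<in> S \<and> y \<in> T}" if "x \<in> L" for x
    using assms(2-4)[OF that] by (intro CollectI exI[of _ x]) simp
qed (use assms(1) in blast)

theorem theorem3p1:
  fixes A :: "complex^'n^'m" and W :: "complex^'m^'n" and k :: nat
  assumes "k = weighted_index A W"
  shows
    "(rank (W ** A ** W) = rank A \<longrightarrow>
        weighted_inverses A W {Eq1, Eq2, Eq3, Eq1k k}
          = {X + (mat 1 - X ** W ** A ** W) ** weighted_drazin A W ** W ** A ** W ** X | X.
               X \<in> weighted_inverses A W {Eq1, Eq2, Eq3}}
      \<and> weighted_inverses A W {Eq1, Eq2, Eq3, Eq1k k}
          = {X + (mat 1 - X ** W ** A ** W) ** Y ** W ** A ** W ** X | X Y.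
               X \<in> weighted_inverses A W {Eq1, Eq2, Eq3} \<and> Y \<in> weighted_inverses A W {Eq1k k}}
      \<and> weighted_inverses A W {Eq1, Eq2, Eq4, Eqk1 k}
          = {X + X ** W ** A ** W ** weighted_drazin A W ** (mat 1 - W ** A ** W ** X) | X.
               X \<in> weighted_inverses A W {Eq1, Eq2, Eq4}}
      \<and> weighted_inverses A W {Eq1, Eq2, Eq4, Eqk1 k}
          = {X + X ** W ** A ** W ** Y ** (mat 1 - W ** A ** W ** X) | X Y.
               X \<in> weighted_inverses A W {Eq1, Eq2, Eq4} \<and> Y \<in> weighted_inverses A W {Eqk1 k}})
     \<and> (weighted_inverses A W {Eq1, Eq2, Eq3, Eq1k k} \<noteq> {} \<longleftrightarrow> rank (W ** A ** W) = rank A)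
     \<and> (weighted_inverses A W {Eq1, Eq2, Eq4, Eqk1 k} \<noteq> {} \<longleftrightarrow> rank (W ** A ** W) = rank A)"
proof -
  let ?S3 = "weighted_inverses A W {Eq1, Eq2, Eq3}" and ?S4 = "weighted_inverses A W {Eq1, Eq2, Eq4}"
  let ?L3 = "weighted_inverses A W {Eq1, Eq2, Eq3, Eq1k k}"
  let ?L4 = "weighted_inverses A W {Eq1, Eq2, Eq4, Eqk1 k}"
  let ?D = "weighted_drazin A W"
  \<comment> \<open>One binary map per family: the second argument is \<open>?D\<close> in the first
    description and any solution of the power equation in the second.\<close>
  let ?F = "\<lambda>X Y. X + (mat 1 - X ** W ** A ** W) ** Y ** W ** A ** W ** X"
  let ?G = "\<lambda>X Y. X + X ** W ** A ** W ** Y ** (mat 1 - W ** A ** W ** X)"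
  note F_mem = mem_weighted_inverses_123k[of _ A W _ k]
  note G_mem = mem_weighted_inverses_124k[of _ A W _ k]
  have D: "?D \<in> weighted_inverses A W {Eq1k k}" "?D \<in> weighted_inverses A W {Eqk1 k}"
    using weighted_drazin_mem[of A W] assms by simp_all
  have L3: "X \<in> ?S3" "X \<in> weighted_inverses A W {Eq1k k}" "?F X ?D = X" "?F X X = X" if "X \<in> ?L3" for X
  proof -
    show "X \<in> ?S3" and 1: "X \<in> weighted_inverses A W {Eq1k k}"
      using that by (simp_all add: weighted_inverses_def)
    show "?F X ?D = X"
      by (simp add: weighted_inverses_123k_drazin[OF 1])
    have "X ** W ** A ** W ** X = X"
      using that by (simp add: weighted_inverses_def)
    then show "?F X X = X"
      by (simp add: matrix_diff_rdistrib)
  qed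
  have L4: "X \<in> ?S4" "X \<in> weighted_inverses A W {Eqk1 k}" "?G X ?D = X" "?G X X = X" if "X \<in> ?L4" for X
  proof -
    show "X \<in> ?S4" and 1: "X \<in> weighted_inverses A W {Eqk1 k}"
      using that by (simp_all add: weighted_inverses_def)
    have "X ** W ** A ** W ** ?D ** (mat 1 - W ** A ** W ** X)
        = X ** W ** A ** W ** (?D ** (mat 1 - W ** A ** W ** X))"
      by (simp only: matrix_mul_assoc)
    then show "?G X ?D = X"
      by (simp add: weighted_inverses_124k_drazin[OF 1])
    have "X ** W ** A ** W ** X = X"
      using that by (simp add: weighted_inverses_def)
    then show "?G X X = X"
      by (simp add: matrix_diff_ldistrib matrix_mul_assoc)
  qed
  have "?L3 = {?F X ?D | X. X \<in> ?S3}"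
    by (rule eq_image_of_fixed_points) (fact F_mem[OF _ D(1)] L3(1,3))+
  moreover have "?L3 = {?F X Y | X Y. X \<in> ?S3 \<and> Y \<in> weighted_inverses A W {Eq1k k}}"
    by (rule eq_image2_of_fixed_points) (fact F_mem L3(1,2,4))+
  moreover have "?L4 = {?G X ?D | X. X \<in> ?S4}"
    by (rule eq_image_of_fixed_points) (fact G_mem[OF _ D(2)] L4(1,3))+
  moreover have "?L4 = {?G X Y | X Y. X \<in> ?S4 \<and> Y \<in> weighted_inverses A W {Eqk1 k}}"
    by (rule eq_image2_of_fixed_points) (fact G_mem L4(1,2,4))+
  moreover have "?L3 \<noteq> {} \<longleftrightarrow> rank (W ** A ** W) = rank A"
  proof
    assume "?L3 \<noteq> {}"
    then show "rank (W ** A ** W) = rank A"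
      using weighted_eq1_imp_rank_eq by (auto simp: weighted_inverses_def)
  next
    assume "rank (W ** A ** W) = rank A"
    \<comment> \<open>The rank condition yields some \<open>X\<close> in \<open>?S3\<close>, and
      \<open>?F X ?D\<close> then lies in \<open>?L3\<close>.\<close>
    then show "?L3 \<noteq> {}"
      using rank_eq_imp_weighted_inverses_123_ne F_mem[OF _ D(1)] by blast
  qed
  moreover have "?L4 \<noteq> {} \<longleftrightarrow> rank (W ** A ** W) = rank A"
  proof
    assume "?L4 \<noteq> {}"
    then show "rank (W ** A ** W) = rank A"
      using weighted_eq1_imp_rank_eq by (auto simp: weighted_inverses_def)
  next
    assume "rank (W ** A ** W) = rank A"
    then show "?L4 \<noteq> {}"
      using rank_eq_imp_weighted_inverses_124_ne G_mem[OF _ D(2)] by blast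
  qed
  ultimately show ?thesis
    by blast
qed

end
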